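(* Let $a_{-1}=1,a_0,\dots,a_l$ be fixed complex constants and set $f(u)=\sum_{i=-1}^{l}a_iu^i$. Suppose that the elements $h^{(p)}_k\in B$ satisfy the recurrence $$h^{(p)}_k=\sum_{i=-1}^{l}a_i\,h^{(p-1)}_{k-i}\qquad (k,p\in\mathbb Z).$$ Then for every $m\in\mathbb Z$ the generating functions $\Psi(u,m)=\sum_{k\in\mathbb Z}\psi_k|_{\mathcal B^{(m)}}u^k$ and $\Psi^*(u,m)=\sum_{k\in\mathbb Z}\psi^*_k|_{\mathcal B^{(m)}}u^{-k}$ are given by $$\Psi(u,m)=u^{m+1}z\,H(u)\,DE(-f(u)),$$ $$\Psi^*(u,m)=u^{-m+1}z^{-1}\,E(-u^{-1})\,DH(f(u)^{-1}),$$ where $H(u)=\sum_{k\in\mathbb Z}h^{(0)}_ku^k$, $E(u)=\sum_{k\in\mathbb Z}e^{(0)}_ku^k$, $DE(u)=\sum_{p\in\mathbb Z}D_pu^p$ and $DH(u)=\sum_{p\in\mathbb Z}D^{(p)}u^p$.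
   Context: Setting. Let $B=\mathbb C[h^{(0)}_1,h^{(0)}_2,\dots]$ be the polynomial ring in independent variables $h^{(0)}_k$ ($k>0$), with $h^{(0)}_0=1$ and $h^{(0)}_k=0$ for $k<0$. $B$ is graded by $\deg h^{(0)}_n=n$, and $B^{\le n}$ is the sum of the homogeneous components of degree $\le n$. Let $\{h^{(r)}_k\}_{k,r\in\mathbb Z}$ be a family of elements of $B$ (extending the $h^{(0)}_k$) with $h^{(r)}_k\in B^{\le k+r}$, $h^{(k)}_{-k}=1$ for all $k\in\mathbb Z$, and $h^{(r)}_k=0$ whenever $k+r<0$. For an integer vector $\lambda=(\lambda_1,\dots,\lambda_n)$ (parts may be negative and in any order), extended by $\lambda_i=0$ for $i>n$, let $s_\lambda\in B$ be the stable value, for large $N$, of $\det\left[h^{(j-1)}_{\lambda_i-i+1}\right]_{1\le i,j\le N}$ (the same for all $N\ge n$). It is required that $\{s_\lambda\}$, $\lambda$ ranging over all partitions, is a linear basis of $B$. Generalized elementary symmetric functions: for $a,p\in\mathbb Z$, $e^{(p)}_a=0$ if $p<a$, $e^{(p)}_a=1$ if $p=a$, and $e^{(p)}_a=\det\left[h^{(-p+j)}_{p+1-i}\right]_{1\le i,j\le p-a}$ if $p>a$. Let $z$ be a variable, $\mathcal B^{(m)}=z^mB$, $\mathcal B=\bigoplus_{m\in\mathbb Z}\mathcal B^{(m)}=B[z,z^{-1}]$. Linear operators $\psi_k,\psi_k^*$ ($k\in\mathbb Z$) on $\mathcal B$ are defined on the basis $\{s_\lambda z^m\}$ ($\lambda$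 a partition, $m\in\mathbb Z$) by $$\psi_k(s_\lambda z^m)=s_{(k-m-1,\lambda_1,\lambda_2,\dots)}z^{m+1},$$ $$\psi^*_k(s_\lambda z^m)=\sum_{t=1}^\infty(-1)^{t+1}\delta_{k-m-1,\,\lambda_t-t}\;s_{(\lambda_1+1,\dots,\lambda_{t-1}+1,\lambda_{t+1},\lambda_{t+2},\dots)}z^{m-1}.$$ Linear operators $D_p$ and $D^{(p)}$ ($p\in\mathbb Z$) on $B$ are defined on $s_\lambda$, $\lambda=(\lambda_1\ge\dots\ge\lambda_n\ge0)$ a partition, by $$D_p(s_\lambda)=\det\left[h^{(j)}_{\lambda_i-i}\right]_{i=1,\dots,n;\;j=0,1,\dots,\widehat p,\dots,n}\ \text{ if }0\le p\le n,\qquad D_p(s_\lambda)=0\ \text{ otherwise}$$ (the column $j=p$ is omitted), and $$D^{(p)}(s_\lambda)=\sum_{t=1}^\infty(-1)^{t+1}h^{(p)}_{\lambda_t-t+2}\,s_{(\lambda_1+1,\dots,\lambda_{t-1}+1,\lambda_{t+1},\lambda_{t+2},\dots)},$$ where $\lambda_t=0$ for $t>n$ (a finite sum). They are extended to $\mathcal B$ by commuting with $z^{\pm1}$. For each fixed element of $B$ only finitely many $D_p$ and finitely many $D^{(p)}$ are nonzero on it ($D_p=0$ for $p<0$, $D^{(p)}=0$ for $p\ge0$, $D^{(p)}(s_\lambda)=0$ for $-p>\lambda_1+1$). Elements of $B$ act by multiplication, after the operators $D_p,D^{(p)}$; $DE(-f(u))=\sum_{p\ge0}(-f(u))^pD_p$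 and $DH(f(u)^{-1})=\sum_{p>0}f(u)^pD^{(-p)}$. The identities are identities of formal series in $u^{\pm1}$. *)

theory Defs
  imports
    "HOL-Library.Poly_Mapping"
    "HOL-Computational_Algebra.Formal_Laurent_Series"
    "Jordan_Normal_Form.Determinant"
begin

text \<open>
  The polynomial ring \<open>B\<close>: monomials are finitely supported exponent vectors.
  The index \<open>i\<close> stands for the variable \<open>h\<^sup>(\<^sup>0\<^sup>)\<^bsub>i+1\<^esub>\<close>, of degree \<open>i + 1\<close>
  (shifted by one so that there is no variable of degree \<open>0\<close>).
\<close>

type_synonym B = "(nat \<Rightarrow>\<^sub>0 nat) \<Rightarrow>\<^sub>0 complex"

definition scaleB :: "complex \<Rightarrow> B \<Rightarrow> B" where
  "scaleB c b = Poly_Mapping.single 0 c * b"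

definition h0 :: "int \<Rightarrow> B" where
  "h0 k = (if k < 0 then 0 else if k = 0 then 1
           else Poly_Mapping.single (Poly_Mapping.single (nat k - 1) 1) 1)"

definition mon_degree :: "(nat \<Rightarrow>\<^sub>0 nat) \<Rightarrow> nat" where
  "mon_degree m = (\<Sum>i\<in>Poly_Mapping.keys m. Poly_Mapping.lookup m i * (i + 1))"

definition B_le :: "int \<Rightarrow> B set" where
  "B_le n = {b. \<forall>m\<in>Poly_Mapping.keys b. int (mon_degree m) \<le> n}"

text \<open>
  Integer vectors are lists \<open>\<lambda>\<close>, with \<open>part \<lambda> i\<close> the \<open>i\<close>-th part counted from \<open>1\<close>,
  extended by zero.  Partitions are represented without trailing zeros, so that each
  partition is represented exactly once.
\<close>

definition part :: "int list \<Rightarrow> nat \<Rightarrow> int" where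
  "part la i = (if 1 \<le> i \<and> i \<le> length la then la ! (i - 1) else 0)"

definition partitions :: "int list set" where
  "partitions = {la. sorted_wrt (\<ge>) la \<and> (\<forall>x\<in>set la. x > 0)}"

definition remove_part :: "nat \<Rightarrow> int list \<Rightarrow> int list" where
  "remove_part t la = map (\<lambda>i. part la i + 1) [1..<t] @ drop t la"

text \<open>
  Throughout, \<open>h r k\<close> is \<open>h\<^sup>(\<^sup>r\<^sup>)\<^sub>k\<close>.  Matrix indices of \<^const>\<open>mat\<close> start at \<open>0\<close>, so the
  entry \<open>(i, j)\<close> below is the entry in row \<open>i + 1\<close> and column \<open>j + 1\<close> of the usual notation.
  The determinant of \<open>schur_mat h \<lambda> N\<close> is the same for all \<open>N \<ge> length \<lambda>\<close>
  (lemma \<open>schur_stable\<close>).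
\<close>

definition schur_mat :: "(int \<Rightarrow> int \<Rightarrow> B) \<Rightarrow> int list \<Rightarrow> nat \<Rightarrow> B mat" where
  "schur_mat h la N = mat N N (\<lambda>(i, j). h (int j) (part la (i + 1) - int i))"

definition schur :: "(int \<Rightarrow> int \<Rightarrow> B) \<Rightarrow> int list \<Rightarrow> B" where
  "schur h la = det (schur_mat h la (length la))"

definition gen_e :: "(int \<Rightarrow> int \<Rightarrow> B) \<Rightarrow> int \<Rightarrow> int \<Rightarrow> B" where
  "gen_e h p a = (if p < a then 0 else if p = a then 1
     else det (mat (nat (p - a)) (nat (p - a)) (\<lambda>(i, j). h (- p + int j + 1) (p - int i))))"

global_interpretation B: vector_space_pair scaleB scaleB
  by unfold_locales
     (simp_all add: scaleB_def distrib_left distrib_right single_add mult_single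
       flip: mult.assoc)

definition schur_basis :: "(int \<Rightarrow> int \<Rightarrow> B) \<Rightarrow> bool" where
  "schur_basis h \<longleftrightarrow> inj_on (schur h) partitions
     \<and> \<not> module.dependent scaleB (schur h ` partitions)
     \<and> module.span scaleB (schur h ` partitions) = UNIV"

text \<open>
  \<open>lin_ext h g\<close> is the linear map with \<open>s\<^sub>\<lambda> \<mapsto> g \<lambda>\<close> for all partitions \<open>\<lambda>\<close>
  (provided that \<open>schur_basis h\<close> holds; see \<open>linear_lin_ext\<close> and \<open>lin_ext_schur\<close>).
\<close>

definition lin_ext :: "(int \<Rightarrow> int \<Rightarrow> B) \<Rightarrow> (int list \<Rightarrow> B) \<Rightarrow> B \<Rightarrow> B" where
  "lin_ext h g = B.construct (schur h ` partitions) (\<lambda>b. g (inv_into partitions (schur h) b))"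

text \<open>
  The matrix defining \<open>D\<^sub>p(s\<^sub>\<lambda>)\<close>: column \<open>p\<close> of the columns \<open>0, \<dots>, length \<lambda>\<close> is omitted.
  The value is not affected by trailing zeros (lemma \<open>D_low_det_snoc_0\<close>).
\<close>

definition D_low_det :: "(int \<Rightarrow> int \<Rightarrow> B) \<Rightarrow> int \<Rightarrow> int list \<Rightarrow> B" where
  "D_low_det h p la = (if 0 \<le> p \<and> p \<le> int (length la)
     then det (mat (length la) (length la)
            (\<lambda>(i, j). h (if int j < p then int j else int j + 1) (part la (i + 1) - int (i + 1))))
     else 0)"

definition D_low :: "(int \<Rightarrow> int \<Rightarrow> B) \<Rightarrow> int \<Rightarrow> B \<Rightarrow> B" where
  "D_low h p = lin_ext h (D_low_det h p)"

definition D_up :: "(int \<Rightarrow> int \<Rightarrow> B) \<Rightarrow> int \<Rightarrow> B \<Rightarrow> B" where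
  "D_up h p = lin_ext h (\<lambda>la.
     \<Sum>t | 1 \<le> t \<and> h p (part la t - int t + 2) \<noteq> 0.
       (- 1) ^ (t + 1) * h p (part la t - int t + 2) * schur h (remove_part t la))"

text \<open>
  \<open>B[z, z\<inverse>]\<close>: the element \<open>b z\<^sup>m\<close> is \<open>single m b\<close>, and \<open>single 0\<close> embeds \<open>B\<close>.
  Since linear maps send \<open>0\<close> to \<open>0\<close>, \<^const>\<open>Poly_Mapping.map\<close> applies a linear map to the
  coefficient of each power of \<open>z\<close>.
\<close>

type_synonym Bz = "int \<Rightarrow>\<^sub>0 B"

definition Bz_comp :: "int \<Rightarrow> Bz set" where
  "Bz_comp m = range (Poly_Mapping.single m)"

definition psi :: "(int \<Rightarrow> int \<Rightarrow> B) \<Rightarrow> int \<Rightarrow> Bz \<Rightarrow> Bz" where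
  "psi h k v = (\<Sum>m\<in>Poly_Mapping.keys v. Poly_Mapping.single (m + 1)
     (lin_ext h (\<lambda>la. schur h ((k - m - 1) # la)) (Poly_Mapping.lookup v m)))"

definition psi_star :: "(int \<Rightarrow> int \<Rightarrow> B) \<Rightarrow> int \<Rightarrow> Bz \<Rightarrow> Bz" where
  "psi_star h k v = (\<Sum>m\<in>Poly_Mapping.keys v. Poly_Mapping.single (m - 1)
     (lin_ext h (\<lambda>la. \<Sum>t | 1 \<le> t \<and> k - m - 1 = part la t - int t.
        (- 1) ^ (t + 1) * schur h (remove_part t la)) (Poly_Mapping.lookup v m)))"

definition Dz_low :: "(int \<Rightarrow> int \<Rightarrow> B) \<Rightarrow> int \<Rightarrow> Bz \<Rightarrow> Bz" where
  "Dz_low h p = Poly_Mapping.map (D_low h p)"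

definition Dz_up :: "(int \<Rightarrow> int \<Rightarrow> B) \<Rightarrow> int \<Rightarrow> Bz \<Rightarrow> Bz" where
  "Dz_up h p = Poly_Mapping.map (D_up h p)"

text \<open>
  The generating functions, applied to an element \<open>v\<close> of \<open>B[z, z\<inverse>]\<close>, as formal series in
  \<open>u\<^sup>\<plusminus>\<^sup>1\<close>, i.e. as functions sending \<open>n\<close> to the coefficient of \<open>u\<^sup>n\<close>.
\<close>

definition Psi :: "(int \<Rightarrow> int \<Rightarrow> B) \<Rightarrow> Bz \<Rightarrow> int \<Rightarrow> Bz" where
  "Psi h v = (\<lambda>n. psi h n v)"

definition Psi_star :: "(int \<Rightarrow> int \<Rightarrow> B) \<Rightarrow> Bz \<Rightarrow> int \<Rightarrow> Bz" where
  "Psi_star h v = (\<lambda>n. psi_star h (- n) v)"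

text \<open>
  The series on the other side are Laurent series in \<open>u\<close> over \<open>B[z, z\<inverse>]\<close>; note that
  \<open>e\<^sup>(\<^sup>0\<^sup>)\<^sub>k = 0\<close> for \<open>k > 0\<close>, so \<open>E(-u\<inverse>)\<close> has no negative powers of \<open>u\<close>.
\<close>

definition constB :: "B \<Rightarrow> Bz fls" where
  "constB b = fls_const (Poly_Mapping.single 0 b)"

definition zpow :: "int \<Rightarrow> Bz fls" where
  "zpow n = fls_const (Poly_Mapping.single n 1)"

definition H_ser :: "(int \<Rightarrow> int \<Rightarrow> B) \<Rightarrow> Bz fls" where
  "H_ser h = Abs_fls (\<lambda>k. Poly_Mapping.single 0 (h 0 k))"

definition E_neg_inv_ser :: "(int \<Rightarrow> int \<Rightarrow> B) \<Rightarrow> Bz fls" where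
  "E_neg_inv_ser h = Abs_fls (\<lambda>n. Poly_Mapping.single 0 ((- 1) ^ nat \<bar>n\<bar> * gen_e h 0 (- n)))"

definition f_ser :: "int \<Rightarrow> (int \<Rightarrow> complex) \<Rightarrow> Bz fls" where
  "f_ser l a = (\<Sum>i = - 1..l. constB (Poly_Mapping.single 0 (a i)) * fls_X_intpow i)"

text \<open>
  \<open>DE_at h g\<close> is \<open>DE(g) = \<Sum>\<^bsub>p\<ge>0\<^esub> g\<^sup>p D\<^sub>p\<close>, and
  \<open>DH_at_inverse h g\<close> is \<open>DH(g\<inverse>) = \<Sum>\<^bsub>p>0\<^esub> g\<^sup>p D\<^sup>(\<^sup>-\<^sup>p\<^sup>)\<close>
  (as \<open>D\<^sub>p = 0\<close> for \<open>p < 0\<close> and \<open>D\<^sup>(\<^sup>p\<^sup>) = 0\<close> for \<open>p \<ge> 0\<close>).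
\<close>

definition DE_at :: "(int \<Rightarrow> int \<Rightarrow> B) \<Rightarrow> Bz fls \<Rightarrow> Bz \<Rightarrow> Bz fls" where
  "DE_at h g v = (\<Sum>p | Dz_low h (int p) v \<noteq> 0. g ^ p * fls_const (Dz_low h (int p) v))"

definition DH_at_inverse :: "(int \<Rightarrow> int \<Rightarrow> B) \<Rightarrow> Bz fls \<Rightarrow> Bz \<Rightarrow> Bz fls" where
  "DH_at_inverse h g v =
     (\<Sum>p | 0 < p \<and> Dz_up h (- int p) v \<noteq> 0. g ^ p * fls_const (Dz_up h (- int p) v))"


subsection \<open>Well-definedness\<close>

lemma det_last_row_unit:
  fixes A :: "'a::comm_ring_1 mat"
  assumes A: "A \<in> carrier_mat (Suc n) (Suc n)"
    and z: "\<And>j. j < n \<Longrightarrow> A $$ (n, j) = 0" and o: "A $$ (n, n) = 1"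
  shows "det A = det (mat_delete A n n)"
proof -
  have "det A = (\<Sum>j<Suc n. A $$ (n, j) * cofactor A n j)"
    by (rule laplace_expansion_row[OF A]) simp
  also have "\<dots> = cofactor A n n" using z o by simp
  also have "\<dots> = det (mat_delete A n n)" by (simp add: cofactor_def flip: mult_2)
  finally show ?thesis .
qed

lemma schur_stable:
  assumes one: "\<And>k. h k (- k) = 1" and zero: "\<And>r k. k + r < 0 \<Longrightarrow> h r k = 0"
    and N: "length la \<le> N"
  shows "det (schur_mat h la N) = schur h la"
  using N
proof (induction N rule: dec_induct)
  case base
  show ?case by (simp add: schur_def)
next
  case (step N)
  have "det (schur_mat h la (Suc N)) = det (mat_delete (schur_mat h la (Suc N)) N N)"
    by (rule det_last_row_unit) (use step one zero in \<open>auto simp: schur_mat_def part_def\<close>)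
  also have "mat_delete (schur_mat h la (Suc N)) N N = schur_mat h la N"
    by (rule eq_matI) (auto simp: mat_delete_def schur_mat_def)
  finally show ?case using step by simp
qed

lemma linear_lin_ext:
  assumes "schur_basis h"
  shows "Vector_Spaces.linear scaleB scaleB (lin_ext h g)"
  unfolding lin_ext_def using assms
  by (intro B.linear_construct) (simp add: schur_basis_def)

lemma lin_ext_schur:
  assumes "schur_basis h" "la \<in> partitions"
  shows "lin_ext h g (schur h la) = g la"
  unfolding lin_ext_def using assms
  by (subst B.construct_basis) (auto simp: schur_basis_def)

lemma lin_ext_0: "schur_basis h \<Longrightarrow> lin_ext h g 0 = 0"
  using B.linear_0 linear_lin_ext by blast

lemma psi_schur:
  assumes "schur_basis h" "la \<in> partitions"
  shows "psi h k (Poly_Mapping.single m (schur h la))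
       = Poly_Mapping.single (m + 1) (schur h ((k - m - 1) # la))"
proof -
  note ext = lin_ext_schur[OF assms, of "\<lambda>la. schur h ((k - m - 1) # la)"]
  show ?thesis
    by (cases "schur h la = 0") (use ext lin_ext_0[OF assms(1)] in \<open>auto simp: psi_def\<close>)
qed

lemma psi_star_schur:
  assumes "schur_basis h" "la \<in> partitions"
  shows "psi_star h k (Poly_Mapping.single m (schur h la))
       = Poly_Mapping.single (m - 1) (\<Sum>t | 1 \<le> t \<and> k - m - 1 = part la t - int t.
           (- 1) ^ (t + 1) * schur h (remove_part t la))"
proof -
  note ext = lin_ext_schur[OF assms, of "\<lambda>la. \<Sum>t | 1 \<le> t \<and> k - m - 1 = part la t - int t.
           (- 1) ^ (t + 1) * schur h (remove_part t la)"]
  show ?thesis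
    by (cases "schur h la = 0")
       (use ext lin_ext_0[OF assms(1)] in \<open>auto simp: psi_star_def simp del: power_Suc\<close>)
qed

lemma D_low_det_snoc_0:
  assumes one: "\<And>k. h k (- k) = 1" and zero: "\<And>r k. k + r < 0 \<Longrightarrow> h r k = 0"
  shows "D_low_det h p (la @ [0]) = D_low_det h p la"
proof -
  define n where "n = length la"
  define M where "M = (\<lambda>la :: int list. mat (length la) (length la)
            (\<lambda>(i, j). h (if int j < p then int j else int j + 1) (part la (i + 1) - int (i + 1))))"
  have dim: "M (la @ [0]) \<in> carrier_mat (Suc n) (Suc n)"
    by (simp add: M_def n_def)
  have part_n: "part (la @ [0]) (Suc n) = 0" by (simp add: part_def n_def)
  have one': "h (1 + k) (- 1 - k) = 1" for k using one[of "1 + k"] by simp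
  consider "p < 0 \<or> p > int n + 1" | "p = int n + 1" | "0 \<le> p" "p \<le> int n" by linarith
  then show ?thesis
  proof cases
    case 1
    then show ?thesis by (auto simp: D_low_det_def n_def)
  next
    case 2
    have "det (M (la @ [0])) = (\<Sum>j<Suc n. M (la @ [0]) $$ (n, j) * cofactor (M (la @ [0])) n j)"
      by (rule laplace_expansion_row[OF dim]) simp
    also have "\<dots> = 0"
      by (rule sum.neutral) (use 2 in \<open>auto simp: M_def part_n zero simp flip: n_def\<close>)
    finally show ?thesis using 2 by (simp add: D_low_det_def M_def n_def)
  next
    case 3
    have "det (M (la @ [0])) = det (mat_delete (M (la @ [0])) n n)"
      by (rule det_last_row_unit[OF dim])
         (use 3 in \<open>auto simp: M_def part_n zero one' add.commute simp flip: n_def\<close>)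
    also have "mat_delete (M (la @ [0])) n n = M la"
      by (rule eq_matI) (auto simp: mat_delete_def M_def n_def part_def nth_append)
    finally show ?thesis using 3 by (simp add: D_low_det_def M_def n_def)
  qed
qed

lemma nth_H_ser:
  assumes "\<And>k. k < 0 \<Longrightarrow> h 0 k = 0"
  shows "fls_nth (H_ser h) k = Poly_Mapping.single 0 (h 0 k)"
  unfolding H_ser_def by (rule nth_Abs_fls_lower_bound[of 0]) (use assms in auto)

lemma nth_E_neg_inv_ser:
  "fls_nth (E_neg_inv_ser h) n = Poly_Mapping.single 0 ((- 1) ^ nat \<bar>n\<bar> * gen_e h 0 (- n))"
  unfolding E_neg_inv_ser_def by (rule nth_Abs_fls_lower_bound[of 0]) (auto simp: gen_e_def)

end

theory Submission
  imports Defs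
begin

text \<open>
  Write \<open>H\<^sup>(\<^sup>r\<^sup>)(u) = \<Sum>\<^sub>k h\<^sup>(\<^sup>r\<^sup>)\<^sub>k u\<^sup>k\<close>; the recurrence says that
  \<open>f H\<^sup>(\<^sup>r\<^sup>) = H\<^sup>(\<^sup>r\<^sup>+\<^sup>1\<^sup>)\<close>.  The formula for \<open>\<Psi>\<close> is then the Laplace expansion of
  \<open>s\<^bsub>(k,\<lambda>)\<^esub>\<close> along its first row.  For \<open>\<Psi>\<^sup>*\<close>, let \<open>L\<close> be the series to be computed and let
  \<open>\<langle>r, F\<rangle>\<close> be the coefficient of \<open>u\<^sup>0\<close> in \<open>H\<^sup>(\<^sup>r\<^sup>) F\<close>.  These pairings determine a Laurent
  series \<open>F\<close>.  One has \<open>\<langle>r, L\<rangle> = D\<^sup>(\<^sup>r\<^sup>)\<close>, which vanishes for \<open>r \<ge> 0\<close> because it is a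
  determinant with two equal columns, and the same determinant for shifted \<open>h\<close> and empty \<open>\<lambda>\<close>
  gives \<open>\<langle>r, E(-u\<inverse>)\<rangle> = \<delta>\<^bsub>r,0\<^esub>\<close>.  Hence \<open>L\<close> and \<open>E(-u\<inverse>) \<Sum>\<^bsub>p>0\<^esub> f\<^sup>p D\<^sup>(\<^sup>-\<^sup>p\<^sup>)\<close>
  have the same pairings.
\<close>

section \<open>Laurent series\<close>

lemma fls_times_nth_bounds:
  fixes f g :: "'a::comm_ring_1 fls"
  assumes f: "\<And>i. i < A \<Longrightarrow> fls_nth f i = 0" and g: "\<And>i. i < B \<Longrightarrow> fls_nth g i = 0"
  shows "fls_nth (f * g) n = (\<Sum>i=A..n - B. fls_nth f i * fls_nth g (n - i))"
  unfolding fls_times_nth(2)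
  by (rule sum.mono_neutral_cong) (use f g in \<open>force simp: not_le\<close>)+

text \<open>The series H^(r)(u), with the coefficient type left open: it is applied to the values of
  \<open>h\<close> embedded in \<open>Bz\<close>.\<close>

definition row_ser :: "(int \<Rightarrow> int \<Rightarrow> 'a::zero) \<Rightarrow> int \<Rightarrow> 'a fls" where
  "row_ser h r = Abs_fls (h r)"

lemma nth_row_ser:
  assumes "\<And>r k. k + r < 0 \<Longrightarrow> h r k = 0"
  shows "fls_nth (row_ser h r) k = h r k"
  unfolding row_ser_def by (rule nth_Abs_fls_lower_bound[of "- r"]) (use assms in auto)

lemma power_times_row_ser:
  fixes h :: "int \<Rightarrow> int \<Rightarrow> 'a::comm_ring_1"
  assumes zero: "\<And>r k. k + r < 0 \<Longrightarrow> h r k = 0"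
    and rec: "\<And>r k. h r k = (\<Sum>i\<in>I. a i * h (r - 1) (k - i))"
  shows "(\<Sum>i\<in>I. fls_const (a i) * fls_X_intpow i) ^ p * row_ser h r = row_ser h (r + int p)"
proof (induction p)
  case (Suc p)
  let ?f = "\<Sum>i\<in>I. fls_const (a i) * fls_X_intpow i"
  have "?f * row_ser h (r - 1) = row_ser h r" for r
  proof (rule fls_eqI)
    fix k
    have "fls_nth (fls_const (a i) * fls_X_intpow i * row_ser h (r - 1)) k
        = a i * h (r - 1) (k - i)" for i
      by (simp only: mult.assoc fls_X_intpow_times_conv_shift(1))
         (simp add: nth_row_ser[of h, OF zero])
    then show "fls_nth (?f * row_ser h (r - 1)) k = fls_nth (row_ser h r) k"
      by (simp add: sum_distrib_right fls_nth_sum nth_row_ser[of h, OF zero] rec[of r k])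
  qed
  from this[of "r + int (Suc p)"] Suc show ?case
    by (simp add: mult.assoc)
qed simp

lemma nth_row_ser_times:
  fixes h :: "int \<Rightarrow> int \<Rightarrow> 'a::comm_ring_1"
  assumes zero: "\<And>r k. k + r < 0 \<Longrightarrow> h r k = 0" and F: "\<And>i. i < - K \<Longrightarrow> fls_nth F i = 0"
  shows "fls_nth (row_ser h r * F) 0 = (\<Sum>k=- r..K. h r k * fls_nth F (- k))"
  using fls_times_nth_bounds[of "- r" "row_ser h r" "- K" F 0] F
  by (simp add: nth_row_ser[of h, OF zero] zero)

text \<open>Pairing with \<open>row_ser h d\<close>, which starts with \<open>u\<^sup>-\<^sup>d\<close>, picks out the
  leading coefficient of a series of order \<open>d\<close>.\<close>

lemma row_ser_separating:
  fixes h :: "int \<Rightarrow> int \<Rightarrow> 'a::comm_ring_1"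
  assumes one: "\<And>k. h k (- k) = 1" and zero: "\<And>r k. k + r < 0 \<Longrightarrow> h r k = 0"
    and F: "\<And>r. fls_nth (row_ser h r * F) 0 = 0"
  shows "F = 0"
proof (rule ccontr)
  assume "F \<noteq> 0"
  have "fls_nth (row_ser h (fls_subdegree F) * F) 0 = fls_nth F (fls_subdegree F)"
    by (subst nth_row_ser_times[of h "- fls_subdegree F", OF zero]) (simp_all add: one)
  with F \<open>F \<noteq> 0\<close> show False by simp
qed

text \<open>Multiplying by \<open>f ^ p\<close> raises the row index by \<open>p\<close>, so by
  \<open>E\<close> the summand for \<open>p\<close> pairs to \<open>d (- int p)\<close> with row
  \<open>- int p\<close> and to 0 with all other rows. By \<open>d\<close> these are all the nonzero
  pairings of \<open>L\<close>, and pairings separate series.\<close>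

lemma row_ser_expansion:
  fixes h :: "int \<Rightarrow> int \<Rightarrow> 'a::comm_ring_1"
  assumes one: "\<And>k. h k (- k) = 1" and zero: "\<And>r k. k + r < 0 \<Longrightarrow> h r k = 0"
    and pow: "\<And>p r. f ^ p * row_ser h r = row_ser h (r + int p)"
    and E: "\<And>r. fls_nth (row_ser h r * E) 0 = (if r = 0 then 1 else 0)"
    and L: "\<And>r. fls_nth (row_ser h r * L) 0 = d r"
    and d: "\<And>r. 0 \<le> r \<or> r < - int P \<Longrightarrow> d r = 0"
  shows "L = E * (\<Sum>p=1..P. f ^ p * fls_const (d (- int p)))"
proof -
  let ?R = "E * (\<Sum>p=1..P. f ^ p * fls_const (d (- int p)))"
  have "fls_nth (row_ser h r * (L - ?R)) 0 = 0" for r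
  proof -
    have "row_ser h r * ?R = (\<Sum>p=1..P. (f ^ p * row_ser h r) * E * fls_const (d (- int p)))"
      by (simp add: sum_distrib_left mult_ac)
    also have "fls_nth \<dots> 0 = (\<Sum>p=1..P. (if r + int p = 0 then 1 else 0) * d (- int p))"
      by (simp add: fls_nth_sum pow E)
    also have "\<dots> = (\<Sum>p\<in>{1..P}. if p = nat (- r) then d r else 0)"
      by (rule sum.cong) auto
    also have "\<dots> = d r"
      by (cases "0 \<le> r \<or> r < - int P") (auto simp: sum.delta d)
    finally show ?thesis by (simp add: right_diff_distrib L)
  qed
  with one zero have "L - ?R = 0" by (intro row_ser_separating[of h]) auto
  then show ?thesis by simp
qed

section \<open>Determinants\<close>

lemma part_remove_part:
  assumes "1 \<le> t" "1 \<le> i"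
  shows "part (remove_part t la) i = (if i < t then part la i + 1 else part la (i + 1))"
  using assms by (auto simp: remove_part_def part_def nth_append)

text \<open>If \<open>t\<close> lies beyond the end of \<open>la\<close>, zero parts are raised to 1
  and kept, so the list may outgrow \<open>la\<close>; otherwise one part is lost.\<close>

lemma length_remove_part: "1 \<le> t \<Longrightarrow> length (remove_part t la) = max (t - 1) (length la - 1)"
  by (auto simp: remove_part_def)

text \<open>The left-hand side is the expansion of a determinant whose columns \<open>0\<close> and \<open>r + 1\<close>
  coincide; it is \<open>D\<^sup>(\<^sup>r\<^sup>)(s\<^sub>\<lambda>)\<close> with all terms written out.\<close>

lemma sum_remove_part_eq_0:
  assumes one: "\<And>k. h k (- k) = 1" and zero: "\<And>r k. k + r < 0 \<Longrightarrow> h r k = 0"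
    and N: "length la \<le> N" "r + 2 \<le> N"
  shows "(\<Sum>t=1..N. (- 1) ^ (t + 1) * h (int r) (part la t - int t + 2) * schur h (remove_part t la)) = 0"
proof -
  \<comment> \<open>Columns \<open>j > 0\<close> carry h^(j-1) with every index raised by one.
    Deleting a row keeps this increase in the rows above it, while renumbering cancels it in the
    rows below, exactly as \<open>remove_part\<close> does.\<close>
  define M where "M = mat N N (\<lambda>(i, j).
    h (if j = 0 then int r else int j - 1) (part la (i + 1) - int i + 1))"
  have M: "M \<in> carrier_mat N N" by (simp add: M_def)
  have cof: "cofactor M i 0 = (- 1) ^ i * schur h (remove_part (i + 1) la)" if "i < N" for i
  proof -
    have "mat_delete M i 0 = schur_mat h (remove_part (i + 1) la) (N - 1)"
      using that by (intro eq_matI)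
        (auto simp: mat_delete_def M_def schur_mat_def part_remove_part algebra_simps)
    \<comment> \<open>The size \<open>N - 1\<close> may exceed the length of the list, so stability
      of the determinant enters here.\<close>
    moreover have "det (schur_mat h (remove_part (i + 1) la) (N - 1)) = schur h (remove_part (i + 1) la)"
      by (rule schur_stable[of h, OF one zero]) (use N that in \<open>auto simp: length_remove_part\<close>)
    ultimately show ?thesis by (simp add: cofactor_def)
  qed
  have "det M = 0"
    by (rule det_identical_columns[OF M, of 0 "r + 1"]) (use N in \<open>auto simp: M_def\<close>)
  moreover have "det M = (\<Sum>i<N. M $$ (i, 0) * cofactor M i 0)"
    by (rule laplace_expansion_column[OF M]) (use N in auto)
  moreover have "\<dots> = (\<Sum>i<N. (- 1) ^ (i + 2) * h (int r) (part la (i + 1) - int (i + 1) + 2)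
      * schur h (remove_part (i + 1) la))"
  proof (rule sum.cong)
    fix i assume "i \<in> {..<N}"
    moreover from this have "M $$ (i, 0) = h (int r) (part la (i + 1) - int (i + 1) + 2)"
      by (simp add: M_def algebra_simps)
    ultimately show "M $$ (i, 0) * cofactor M i 0 = (- 1) ^ (i + 2)
        * h (int r) (part la (i + 1) - int (i + 1) + 2) * schur h (remove_part (i + 1) la)"
      by (simp add: cof)
  qed simp
  moreover have "\<dots> = (\<Sum>t=1..N. (- 1) ^ (t + 1) * h (int r) (part la t - int t + 2)
      * schur h (remove_part t la))"
    by (rule sum.reindex_bij_witness[of _ "\<lambda>t. t - 1" "\<lambda>i. i + 1"]) auto
  ultimately show ?thesis by simp
qed

text \<open>Applied to the empty list, \<open>remove_part\<close> yields the columns (1,...,1),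
  whose Schur determinants for \<open>h'\<close> are the \<open>gen_e h 0\<close>. The shift in
  \<open>h'\<close> preserves \<open>k + r\<close>, so \<open>one\<close> and \<open>zero\<close>
  carry over, and row \<open>n - 1\<close> of \<open>h'\<close> is row \<open>n\<close> of
  \<open>h\<close>.\<close>

lemma sum_gen_e_eq_0:
  assumes one: "\<And>k. h k (- k) = 1" and zero: "\<And>r k. k + r < 0 \<Longrightarrow> h r k = 0"
    and n: "0 < n"
  shows "(\<Sum>k=- int n..0. h (int n) k * ((- 1) ^ nat \<bar>k\<bar> * gen_e h 0 k)) = 0"
proof -
  define h' where "h' = (\<lambda>r k. h (r + 1) (k - 1))"
  have one': "h' k (- k) = 1" for k using one[of "k + 1"] by (simp add: h'_def)
  have zero': "h' r k = 0" if "k + r < 0" for r k using that by (simp add: h'_def zero)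
  have e: "gen_e h 0 (- int s) = schur h' (remove_part (s + 1) [])" for s
  proof (cases "s = 0")
    case False
    have "part (remove_part (s + 1) []) (i + 1) = 1" if "i < s" for i
      using that by (subst part_remove_part) (simp_all add: part_def)
    then have "mat s s (\<lambda>(i, j). h (int j + 1) (- int i)) = schur_mat h' (remove_part (s + 1) []) s"
      by (intro eq_matI) (auto simp: schur_mat_def h'_def)
    with False show ?thesis
      by (simp add: gen_e_def schur_def length_remove_part)
  qed (simp add: gen_e_def schur_def remove_part_def schur_mat_def)
  have e: "schur h' (remove_part t []) = gen_e h 0 (1 - int t)" if "1 \<le> t" for t
    using e[of "t - 1"] that by (simp add: of_nat_diff)
  have summand: "(- 1) ^ (t + 1) * h' (int (n - 1)) (part [] t - int t + 2) * schur h' (remove_part t [])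
      = h (int n) (1 - int t) * ((- 1) ^ nat \<bar>1 - int t\<bar> * gen_e h 0 (1 - int t))"
    if "1 \<le> t" for t
  proof -
    obtain s where t: "t = Suc s" using \<open>1 \<le> t\<close> not0_implies_Suc by force
    have "h' (int (n - 1)) (part [] t - int t + 2) = h (int n) (1 - int t)"
      using n that by (simp add: h'_def part_def of_nat_diff)
    then show ?thesis using e[OF that] by (simp add: t mult_ac)
  qed
  have "(\<Sum>t=1..n + 1. (- 1) ^ (t + 1) * h' (int (n - 1)) (part [] t - int t + 2)
      * schur h' (remove_part t [])) = 0"
    by (rule sum_remove_part_eq_0[of h', OF one' zero']) (use n in auto)
  also have "(\<Sum>t=1..n + 1. (- 1) ^ (t + 1) * h' (int (n - 1)) (part [] t - int t + 2)
      * schur h' (remove_part t []))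
    = (\<Sum>k=- int n..0. h (int n) k * ((- 1) ^ nat \<bar>k\<bar> * gen_e h 0 k))"
    by (rule sum.reindex_bij_witness[of _ "\<lambda>k. nat (1 - k)" "\<lambda>t. 1 - int t"])
       (use n summand in auto)
  finally show ?thesis .
qed

lemma schur_Cons:
  "schur h (k # la) = (\<Sum>p\<le>length la. (- 1) ^ p * h (int p) k * D_low_det h (int p) la)"
proof -
  define n where "n = length la"
  define M where "M = schur_mat h (k # la) (Suc n)"
  have M: "M \<in> carrier_mat (Suc n) (Suc n)" by (simp add: M_def schur_mat_def)
  \<comment> \<open>Without the row of \<open>k\<close>, the parts of \<open>la\<close> move up one
    row but keep their old offset, whence \<open>- int (i + 1)\<close> in
    \<open>D_low_det\<close>.\<close>
  have cof: "cofactor M 0 p = (- 1) ^ p * D_low_det h (int p) la" if "p < Suc n" for p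
  proof -
    have "mat_delete M 0 p = mat n n (\<lambda>(i, j).
        h (if int j < int p then int j else int j + 1) (part la (i + 1) - int (i + 1)))"
      by (intro eq_matI)
         (auto simp: mat_delete_def M_def schur_mat_def part_def n_def nth_Cons' algebra_simps)
    with that show ?thesis by (simp add: cofactor_def D_low_det_def flip: n_def)
  qed
  have "schur h (k # la) = det M" by (simp add: schur_def M_def n_def)
  also have "\<dots> = (\<Sum>p<Suc n. M $$ (0, p) * cofactor M 0 p)"
    by (rule laplace_expansion_row[OF M]) simp
  also have "\<dots> = (\<Sum>p<Suc n. (- 1) ^ p * h (int p) k * D_low_det h (int p) la)"
    by (rule sum.cong) (auto simp: cof, simp add: M_def schur_mat_def part_def mult_ac)
  finally show ?thesis by (simp only: lessThan_Suc_atMost n_def)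
qed

section \<open>Extension from the basis\<close>

lemma schur_basis_induct [consumes 1, case_names zero step]:
  assumes "schur_basis h" and "P 0"
    and "\<And>c la b. la \<in> partitions \<Longrightarrow> P b \<Longrightarrow> P (scaleB c (schur h la) + b)"
  shows "P b"
proof -
  have "b \<in> module.span scaleB (schur h ` partitions)"
    using assms(1) by (simp add: schur_basis_def)
  then show ?thesis
    by (induction rule: B.vs1.span_induct_alt) (use assms in auto)
qed

lemma lin_ext_step:
  assumes "schur_basis h" "la \<in> partitions"
  shows "lin_ext h g (scaleB c (schur h la) + b) = Poly_Mapping.single 0 c * g la + lin_ext h g b"
  using B.linear_add[OF linear_lin_ext[OF assms(1)]] B.linear_scale[OF linear_lin_ext[OF assms(1)]]
    lin_ext_schur[OF assms] by (simp add: scaleB_def)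

text \<open>The bound \<open>N\<close> depends on \<open>b\<close> but not on \<open>k\<close>, so
  one finite sum over \<open>p\<close> serves all coefficients of the series. Quantifying over all
  larger \<open>M\<close> lets the induction merge two bounds.\<close>

lemma lin_ext_schur_Cons:
  assumes "schur_basis h"
  shows "\<exists>N. \<forall>M\<ge>N. D_low h (int M) b = 0 \<and> (\<forall>k. lin_ext h (\<lambda>la. schur h (k # la)) b
      = (\<Sum>p<M. (- 1) ^ p * h (int p) k * D_low h (int p) b))"
  using assms
proof (induction b rule: schur_basis_induct)
  case zero
  show ?case by (simp add: D_low_def lin_ext_0[OF assms])
next
  case (step c la b)
  from step.IH obtain N where N: "D_low h (int M) b = 0"
      "lin_ext h (\<lambda>la. schur h (k # la)) b = (\<Sum>p<M. (- 1) ^ p * h (int p) k * D_low h (int p) b)"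
    if "N \<le> M" for M k by blast
  note ext = lin_ext_step[OF assms step.hyps]
  show ?case
  proof (intro exI[of _ "max N (length la + 1)"] allI impI conjI)
    fix M k assume M: "max N (length la + 1) \<le> M"
    then show "D_low h (int M) (scaleB c (schur h la) + b) = 0"
      using N(1)[of M] by (simp add: D_low_def ext D_low_det_def)
    have "schur h (k # la) = (\<Sum>p<M. (- 1) ^ p * h (int p) k * D_low_det h (int p) la)"
      unfolding schur_Cons
      by (rule sum.mono_neutral_left) (use M in \<open>auto simp: D_low_det_def\<close>)
    then show "lin_ext h (\<lambda>la. schur h (k # la)) (scaleB c (schur h la) + b)
        = (\<Sum>p<M. (- 1) ^ p * h (int p) k * D_low h (int p) (scaleB c (schur h la) + b))"
      using N(2)[of M k] M
      by (simp add: ext D_low_def sum_distrib_left distrib_left sum.distrib mult_ac)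
  qed
qed

text \<open>With \<open>c = k - m - 1\<close> this is the coefficient that \<open>psi_star\<close>
  assigns to a Schur element. For a partition, \<open>part la t - int t\<close> strictly decreases
  in \<open>t\<close>, so at most one term occurs.\<close>

definition removal_sum :: "(int \<Rightarrow> int \<Rightarrow> B) \<Rightarrow> int \<Rightarrow> int list \<Rightarrow> B" where
  "removal_sum h c la =
     (\<Sum>t | 1 \<le> t \<and> c = part la t - int t. (- 1) ^ (t + 1) * schur h (remove_part t la))"

definition D_up_sum :: "(int \<Rightarrow> int \<Rightarrow> B) \<Rightarrow> int \<Rightarrow> int list \<Rightarrow> B" where
  "D_up_sum h r la = (\<Sum>t | 1 \<le> t \<and> h r (part la t - int t + 2) \<noteq> 0.
     (- 1) ^ (t + 1) * h r (part la t - int t + 2) * schur h (remove_part t la))"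

lemma D_up_sum_eq:
  assumes zero: "\<And>r k. k + r < 0 \<Longrightarrow> h r k = 0" and N: "int (length la) \<le> N" "r + 2 \<le> N"
  shows "D_up_sum h r la = (\<Sum>t=1..nat N.
    (- 1) ^ (t + 1) * h r (part la t - int t + 2) * schur h (remove_part t la))"
  unfolding D_up_sum_def
proof (rule sum.mono_neutral_left)
  show "{t. 1 \<le> t \<and> h r (part la t - int t + 2) \<noteq> 0} \<subseteq> {1..nat N}"
  proof
    fix t assume t: "t \<in> {t. 1 \<le> t \<and> h r (part la t - int t + 2) \<noteq> 0}"
    have "t \<le> nat N"
    proof (rule ccontr)
      assume "\<not> t \<le> nat N"
      \<comment> \<open>Beyond \<open>N\<close> the part is zero and the index
        \<open>2 - int t\<close> falls below \<open>- r\<close>.\<close>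
      with N have "part la t = 0" "2 - int t + r < 0" by (auto simp: part_def)
      with t zero[of "2 - int t" r] show False by simp
    qed
    with t show "t \<in> {1..nat N}" by simp
  qed
qed auto

lemma D_up_sum_nonneg:
  assumes one: "\<And>k. h k (- k) = 1" and zero: "\<And>r k. k + r < 0 \<Longrightarrow> h r k = 0"
    and r: "0 \<le> r"
  shows "D_up_sum h r la = 0"
proof -
  define N where "N = max (length la) (nat r + 2)"
  have "D_up_sum h r la = (\<Sum>t=1..nat (int N).
    (- 1) ^ (t + 1) * h r (part la t - int t + 2) * schur h (remove_part t la))"
    by (rule D_up_sum_eq[of h, OF zero]) (auto simp: N_def)
  also have "\<dots> = 0"
    using sum_remove_part_eq_0[of h la N "nat r", OF one zero] r by (simp add: N_def)
  finally show ?thesis .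
qed

lemma part_bounded: "\<exists>K. \<forall>t. part la t \<le> K"
proof (intro exI allI)
  fix t
  have "part la t \<in> insert 0 (set la)" by (auto simp: part_def)
  then show "part la t \<le> Max (insert 0 (set la))" by (intro Max_ge) auto
qed

text \<open>Terms are grouped by \<open>k = part la t - int t + 2\<close>: they share the factor
  \<open>h r k\<close>, and the rest is the removal sum at \<open>k - 2\<close>. This realizes D^(r)
  as the pairing of row \<open>r\<close> with the series of removal sums.\<close>

lemma D_up_sum_removal:
  assumes zero: "\<And>r k. k + r < 0 \<Longrightarrow> h r k = 0" and K: "\<And>t. part la t + 1 \<le> K"
  shows "D_up_sum h r la = (\<Sum>k=- r..K. h r k * removal_sum h (k - 2) la)"
proof -
  let ?k = "\<lambda>t. part la t - int t + 2"
  let ?T = "{t. 1 \<le> t \<and> - r \<le> ?k t}"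
  let ?g = "\<lambda>t. (- 1) ^ (t + 1) * h r (?k t) * schur h (remove_part t la)"
  have "?T \<subseteq> {..nat (K + r + 1)}"
  proof
    fix t assume "t \<in> ?T"
    with K[of t] show "t \<in> {..nat (K + r + 1)}" by simp linarith
  qed
  then have fin: "finite ?T" by (rule finite_subset) simp
  have ge: "- r \<le> ?k t" if "h r (?k t) \<noteq> 0" for t
    using zero[of "?k t" r] that by linarith
  have le: "?k t \<le> K" if "1 \<le> t" for t using K[of t] that by simp
  have "D_up_sum h r la = sum ?g ?T"
    unfolding D_up_sum_def
    by (rule sum.mono_neutral_left) (use fin ge in auto)
  also have "\<dots> = (\<Sum>k=- r..K. sum ?g {t \<in> ?T. ?k t = k})"
    by (rule sum.group[symmetric]) (use fin le in auto)
  also have "\<dots> = (\<Sum>k=- r..K. h r k * removal_sum h (k - 2) la)"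
  proof (rule sum.cong)
    fix k assume "k \<in> {- r..K}"
    then have "{t \<in> ?T. ?k t = k} = {t. 1 \<le> t \<and> k - 2 = part la t - int t}" by auto
    then show "sum ?g {t \<in> ?T. ?k t = k} = h r k * removal_sum h (k - 2) la"
      unfolding removal_sum_def sum_distrib_left
      by (intro sum.cong) (auto simp: mult_ac)
  qed simp
  finally show ?thesis .
qed

lemma removal_sum_eq_0:
  assumes "\<And>t. part la t + 1 \<le> K" "K < c + 2"
  shows "removal_sum h c la = 0"
proof -
  have "{t. 1 \<le> t \<and> c = part la t - int t} = {}" using assms by (smt (verit) Collect_empty_eq of_nat_1 of_nat_mono)
  then show ?thesis by (simp only: removal_sum_def sum.empty)
qed

lemma D_up_alt: "D_up h r = lin_ext h (D_up_sum h r)"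
  unfolding D_up_def D_up_sum_def ..

text \<open>The bound \<open>K\<close> depends on \<open>b\<close> alone; the vanishing for large
  \<open>c\<close> bounds the pole of the series of removal sums, which is thus a Laurent
  series.\<close>

lemma D_up_eq_sum_removal:
  assumes one: "\<And>k. h k (- k) = 1" and zero: "\<And>r k. k + r < 0 \<Longrightarrow> h r k = 0"
    and basis: "schur_basis h"
  shows "\<exists>K. \<forall>M\<ge>K. (\<forall>c>M - 2. lin_ext h (removal_sum h c) b = 0)
    \<and> (\<forall>r. (0 \<le> r \<longrightarrow> D_up h r b = 0)
      \<and> D_up h r b = (\<Sum>k=- r..M. h r k * lin_ext h (removal_sum h (k - 2)) b))"
  using basis
proof (induction b rule: schur_basis_induct)
  case zero
  show ?case by (simp add: D_up_alt lin_ext_0[OF basis])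
next
  case (step c la b)
  from step.IH obtain K where K: "\<forall>M\<ge>K. (\<forall>c>M - 2. lin_ext h (removal_sum h c) b = 0)
    \<and> (\<forall>r. (0 \<le> r \<longrightarrow> D_up h r b = 0)
      \<and> D_up h r b = (\<Sum>k=- r..M. h r k * lin_ext h (removal_sum h (k - 2)) b))" ..
  then have K0: "\<And>M d. K \<le> M \<Longrightarrow> d > M - 2 \<Longrightarrow> lin_ext h (removal_sum h d) b = 0"
    and K1: "\<And>r. 0 \<le> r \<Longrightarrow> D_up h r b = 0"
    by blast+
  obtain K' where K': "part la t \<le> K'" for t using part_bounded by blast
  note ext = lin_ext_step[OF basis step.hyps]
  show ?case
  proof (intro exI[of _ "max K (K' + 1)"] allI impI conjI)
    fix M assume M: "max K (K' + 1) \<le> M"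
    have part: "part la t + 1 \<le> M" for t using K'[of t] M by simp
    show "lin_ext h (removal_sum h d) (scaleB c (schur h la) + b) = 0" if "d > M - 2" for d
      using K0[of M d] M that removal_sum_eq_0[of la M d h] part
      by (simp add: ext)
    show "D_up h r (scaleB c (schur h la) + b) = 0" if "0 \<le> r" for r
      using K1[of r] that D_up_sum_nonneg[of h r la, OF one zero]
      by (simp add: D_up_alt ext)
    show "D_up h r (scaleB c (schur h la) + b)
        = (\<Sum>k=- r..M. h r k * lin_ext h (removal_sum h (k - 2)) (scaleB c (schur h la) + b))" for r
      using K[rule_format, of M] M D_up_sum_removal[of h la M r, OF zero part]
      by (simp add: D_up_alt ext sum_distrib_left distrib_left sum.distrib mult_ac)
  qed
qed

section \<open>The generating functions\<close>

lemma single_sum: "Poly_Mapping.single k (sum f A) = (\<Sum>x\<in>A. Poly_Mapping.single k (f x))"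
  by (induction A rule: infinite_finite_induct) (simp_all add: single_add)

lemma f_ser_power_times:
  assumes zero: "\<And>r k. k + r < 0 \<Longrightarrow> h r k = 0"
    and rec: "\<And>p k. h p k = (\<Sum>i = - 1..l. scaleB (a i) (h (p - 1) (k - i)))"
  shows "f_ser l a ^ p * row_ser (\<lambda>r k. Poly_Mapping.single 0 (h r k)) r
    = row_ser (\<lambda>r k. Poly_Mapping.single 0 (h r k)) (r + int p)"
  unfolding f_ser_def constB_def
proof (rule power_times_row_ser)
  show "Poly_Mapping.single 0 (h r k) = (\<Sum>i = - 1..l.
      Poly_Mapping.single 0 (Poly_Mapping.single 0 (a i)) * Poly_Mapping.single 0 (h (r - 1) (k - i)))"
    for r k
    by (subst rec) (simp add: single_sum mult_single scaleB_def)
qed (simp add: zero)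

lemma nth_intpow_zpow_times:
  "fls_nth (fls_X_intpow i * zpow j * F * G) n = Poly_Mapping.single j 1 * fls_nth (F * G) (n - i)"
  unfolding mult.assoc unfolding fls_X_intpow_times_conv_shift(1) fls_shift_nth by (simp add: zpow_def)

lemma Psi_eq:
  assumes zero: "\<And>r k. k + r < 0 \<Longrightarrow> h r k = 0" and basis: "schur_basis h"
    and rec: "\<And>p k. h p k = (\<Sum>i = - 1..l. scaleB (a i) (h (p - 1) (k - i)))"
  shows "Psi h (Poly_Mapping.single m b) = fls_nth (fls_X_intpow (m + 1) * zpow 1 * H_ser h
    * DE_at h (- f_ser l a) (Poly_Mapping.single m b))"
proof
  fix n
  let ?h = "\<lambda>r k. Poly_Mapping.single (0::int) (h r k)"
  obtain N where N0: "\<And>p. N \<le> p \<Longrightarrow> D_low h (int p) b = 0"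
    and N: "\<And>k. lin_ext h (\<lambda>la. schur h (k # la)) b
      = (\<Sum>p<N. (- 1) ^ p * h (int p) k * D_low h (int p) b)"
    using lin_ext_schur_Cons[OF basis, of b] by blast
  have Dz: "Dz_low h p (Poly_Mapping.single m b) = Poly_Mapping.single m (D_low h p b)" for p
    using lin_ext_0[OF basis] by (auto simp: Dz_low_def D_low_def)
  have "DE_at h (- f_ser l a) (Poly_Mapping.single m b)
      = (\<Sum>p<N. (- f_ser l a) ^ p * fls_const (Poly_Mapping.single m (D_low h (int p) b)))"
    unfolding DE_at_def Dz
    by (rule sum.mono_neutral_left) (use N0 in \<open>force simp: not_le[symmetric]\<close>)+
  \<comment> \<open>The sign is split off from \<open>(- f_ser l a) ^ p\<close>; the remaining power
    then turns row 0, which is \<open>H_ser h\<close>, into row \<open>p\<close>.\<close>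
  also have "H_ser h * \<dots> = (\<Sum>p<N. (- 1) ^ p * (f_ser l a ^ p * row_ser ?h 0)
      * fls_const (Poly_Mapping.single m (D_low h (int p) b)))"
    unfolding H_ser_def row_ser_def sum_distrib_left
    by (rule sum.cong) (simp_all add: power_minus[of "f_ser l a"] mult_ac)
  also have "\<dots> = (\<Sum>p<N. (- 1) ^ p * row_ser ?h (int p)
      * fls_const (Poly_Mapping.single m (D_low h (int p) b)))"
    by (simp add: f_ser_power_times[of h, OF zero rec])
  finally have series: "H_ser h * DE_at h (- f_ser l a) (Poly_Mapping.single m b)
      = (\<Sum>p<N. (- 1) ^ p * row_ser ?h (int p)
      * fls_const (Poly_Mapping.single m (D_low h (int p) b)))" .
  have "fls_nth (H_ser h * DE_at h (- f_ser l a) (Poly_Mapping.single m b)) k = Poly_Mapping.single m (lin_ext h (\<lambda>la. schur h (k # la)) b)" for k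
    unfolding series N single_sum fls_nth_sum
    by (rule sum.cong) (auto simp: minus_one_power_iff nth_row_ser[of ?h] zero mult_single single_uminus)
  moreover have "Psi h (Poly_Mapping.single m b) n
      = Poly_Mapping.single (m + 1) (lin_ext h (\<lambda>la. schur h ((n - m - 1) # la)) b)"
    using lin_ext_0[OF basis] by (auto simp: Psi_def psi_def)
  ultimately show "Psi h (Poly_Mapping.single m b) n = fls_nth (fls_X_intpow (m + 1) * zpow 1 * H_ser h
      * DE_at h (- f_ser l a) (Poly_Mapping.single m b)) n"
    unfolding nth_intpow_zpow_times by (simp add: mult_single diff_diff_eq add.commute)
qed

lemma row_ser_times_E_neg_inv_ser:
  assumes one: "\<And>k. h k (- k) = 1" and zero: "\<And>r k. k + r < 0 \<Longrightarrow> h r k = 0"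
  shows "fls_nth (row_ser (\<lambda>r k. Poly_Mapping.single 0 (h r k)) r * E_neg_inv_ser h) 0
    = (if r = 0 then 1 else 0)"
proof -
  have "fls_nth (row_ser (\<lambda>r k. Poly_Mapping.single 0 (h r k)) r * E_neg_inv_ser h) 0
    = (\<Sum>k=- r..0. Poly_Mapping.single 0 (h r k) * fls_nth (E_neg_inv_ser h) (- k))"
    by (rule nth_row_ser_times) (auto simp: zero nth_E_neg_inv_ser gen_e_def)
  also have "\<dots> = Poly_Mapping.single 0 (\<Sum>k=- r..0. h r k * ((- 1) ^ nat \<bar>k\<bar> * gen_e h 0 k))"
    by (simp add: nth_E_neg_inv_ser single_sum mult_single)
  \<comment> \<open>For \<open>r < 0\<close> the range is empty, for \<open>r = 0\<close> the only
    term is 1, and \<open>r > 0\<close> is the determinant identity.\<close>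
  also have "(\<Sum>k=- r..0. h r k * ((- 1) ^ nat \<bar>k\<bar> * gen_e h 0 k)) = (if r = 0 then 1 else 0)"
    using sum_gen_e_eq_0[of h "nat r", OF one zero] one[of 0]
    by (cases "0 < r") (auto simp: gen_e_def)
  finally show ?thesis by simp
qed

lemma Psi_star_eq:
  assumes one: "\<And>k. h k (- k) = 1" and zero: "\<And>r k. k + r < 0 \<Longrightarrow> h r k = 0"
    and basis: "schur_basis h"
    and rec: "\<And>p k. h p k = (\<Sum>i = - 1..l. scaleB (a i) (h (p - 1) (k - i)))"
  shows "Psi_star h (Poly_Mapping.single m b) = fls_nth (fls_X_intpow (- m + 1) * zpow (- 1)
    * E_neg_inv_ser h * DH_at_inverse h (f_ser l a) (Poly_Mapping.single m b))"
proof
  fix n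
  let ?h = "\<lambda>r k. Poly_Mapping.single (0::int) (h r k)"
  define d where "d = (\<lambda>r. Poly_Mapping.single m (D_up h r b))"
  \<comment> \<open>The coefficient at u^(-k) is the removal sum at \<open>k - 2\<close>, the one
    that \<open>K2\<close> pairs with \<open>h r k\<close>. The factor u^(-m+1) accounts for the
    remaining offset from \<open>psi_star\<close>.\<close>
  define L where "L = Abs_fls (\<lambda>i. Poly_Mapping.single m (lin_ext h (removal_sum h (- i - 2)) b))"
  obtain K where K0: "\<And>c. c > K - 2 \<Longrightarrow> lin_ext h (removal_sum h c) b = 0"
    and K1: "\<And>r. 0 \<le> r \<Longrightarrow> D_up h r b = 0"
    and K2: "\<And>r. D_up h r b = (\<Sum>k=- r..K. h r k * lin_ext h (removal_sum h (k - 2)) b)"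
    using D_up_eq_sum_removal[of h b, OF one zero basis] by blast
  have L: "fls_nth L i = Poly_Mapping.single m (lin_ext h (removal_sum h (- i - 2)) b)" for i
    unfolding L_def by (rule nth_Abs_fls_lower_bound[of "- K"]) (simp add: K0)
  have d: "d r = 0" if "0 \<le> r \<or> r < - int (nat K)" for r
    using that
  proof
    assume "0 \<le> r"
    then show ?thesis by (simp add: d_def K1)
  next
    assume "r < - int (nat K)"
    \<comment> \<open>Here \<open>K \<le> int (nat K) < - r\<close>.\<close>
    then have "{- r..K} = {}" by (simp add: not_le split: if_splits)
    then show ?thesis by (simp add: d_def K2[of r])
  qed
  have "L = E_neg_inv_ser h * (\<Sum>p=1..nat K. f_ser l a ^ p * fls_const (d (- int p)))"
  proof (rule row_ser_expansion[of ?h])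
    show "fls_nth (row_ser ?h r * L) 0 = d r" for r
    proof -
      have "fls_nth (row_ser ?h r * L) 0 = (\<Sum>k=- r..K. ?h r k * fls_nth L (- k))"
        by (rule nth_row_ser_times) (auto simp: zero L K0)
      then show ?thesis
        by (simp add: L d_def K2[of r] single_sum mult_single)
    qed
  qed (use one zero d f_ser_power_times[of h, OF zero rec]
      row_ser_times_E_neg_inv_ser[of h, OF one zero] in auto)
  also have "(\<Sum>p=1..nat K. f_ser l a ^ p * fls_const (d (- int p)))
      = DH_at_inverse h (f_ser l a) (Poly_Mapping.single m b)"
  proof -
    have "Dz_up h r (Poly_Mapping.single m b) = d r" for r
      using lin_ext_0[OF basis] by (auto simp: Dz_up_def D_up_def d_def)
    \<comment> \<open>The range \<open>1..nat K\<close> contains every positive \<open>p\<close>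
      with \<open>d (- int p)\<close> nonzero; its other terms vanish.\<close>
    then show ?thesis
      unfolding DH_at_inverse_def
      by (auto intro!: sum.mono_neutral_right) (metis d neg_less_iff_less not_le of_nat_less_iff)
  qed
  finally have series: "L = E_neg_inv_ser h * DH_at_inverse h (f_ser l a) (Poly_Mapping.single m b)" .
  have "Psi_star h (Poly_Mapping.single m b) n
      = Poly_Mapping.single (m - 1) (lin_ext h (removal_sum h (- n - m - 1)) b)"
    using lin_ext_0[OF basis] by (auto simp: Psi_star_def psi_star_def removal_sum_def[abs_def])
  moreover have "- (n - (- m + 1)) - 2 = - n - m - 1" by simp
  ultimately show "Psi_star h (Poly_Mapping.single m b) n = fls_nth (fls_X_intpow (- m + 1) * zpow (- 1)
      * E_neg_inv_ser h * DH_at_inverse h (f_ser l a) (Poly_Mapping.single m b)) n"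
    unfolding nth_intpow_zpow_times series[symmetric] L by (simp only: mult_single) simp
qed

theorem proposition5p4:
  fixes h :: "int \<Rightarrow> int \<Rightarrow> B" and a :: "int \<Rightarrow> complex" and l :: int
  assumes h_var: "\<And>k. h 0 k = h0 k"
    and h_degree: "\<And>r k. h r k \<in> B_le (k + r)"
    and h_one: "\<And>k. h k (- k) = 1"
    and h_zero: "\<And>r k. k + r < 0 \<Longrightarrow> h r k = 0"
    and basis: "schur_basis h"
    and l: "- 1 \<le> l"
    and a: "a (- 1) = 1"
    and recurrence: "\<And>p k. h p k = (\<Sum>i = - 1..l. scaleB (a i) (h (p - 1) (k - i)))"
  shows "\<forall>m. \<forall>v\<in>Bz_comp m.
      Psi h v = fls_nth (fls_X_intpow (m + 1) * zpow 1 * H_ser h * DE_at h (- f_ser l a) v)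
    \<and> Psi_star h v =
        fls_nth (fls_X_intpow (- m + 1) * zpow (- 1) * E_neg_inv_ser h * DH_at_inverse h (f_ser l a) v)"
  using Psi_eq[of h, OF h_zero basis recurrence] Psi_star_eq[of h, OF h_one h_zero basis recurrence]
  by (auto simp: Bz_comp_def)

end
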